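(* Let $\mathbb T:=\{e^{it}:t\in\mathbb R\}$ be endowed with the chordal metric $d(e^{it},e^{is})=|e^{it}-e^{is}|$ and with base point $1$. Then $\operatorname{Lip}_0(\mathbb T)$ has the ball-covering property (BCP), but it fails the uniform ball-covering property (UBCP).
   Context: $\operatorname{Lip}_0(\mathbb T)$ is the real Banach space of all Lipschitz functions $f:\mathbb T\to\mathbb R$ vanishing at the base point, with norm $\|f\|=\sup\{|f(x)-f(y)|/d(x,y):x\ne y\}$. Let $Z$ be a Banach space with unit sphere $S_Z$, and let $B(z,r)$ be the open ball with center $z$ and radius $r>0$. $Z$ has the BCP if there is a countable collection of open balls $\{B(z_n,r_n)\}$ with $S_Z\subset\bigcup_nB(z_n,r_n)$ and $\|z_n\|\ge r_n$ for all $n$. $Z$ has the UBCP if there are $r,\alpha>0$ and a countable collection of open balls $\{B(z_n,r_n)\}$ with $S_Z\subset\bigcup_nB(z_n,r_n)$, $\|z_n\|\ge r_n+\alpha$ for all $n$, and $\sup_n r_n\le r$. *)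

theory Defs
  imports "HOL-Analysis.Analysis"
begin

section \<open>The circle with the chordal metric\<close>

typedef circle = "{cis t | t :: real. True}"
  morphisms complex_of_circle Abs_circle
  by blast

setup_lifting type_definition_circle

instantiation circle :: metric_space
begin

lift_definition dist_circle :: "circle \<Rightarrow> circle \<Rightarrow> real" is "\<lambda>z w. cmod (z - w)" .

definition uniformity_circle :: "(circle \<times> circle) filter"
  where "uniformity_circle = (INF e\<in>{0 <..}. principal {(x, y). dist x y < e})"

definition open_circle :: "circle set \<Rightarrow> bool"
  where "open_circle U = (\<forall>x\<in>U. \<forall>\<^sub>F (x', y) in uniformity. x' = x \<longrightarrow> y \<in> U)"

instance
proof
  fix x y z :: circle
  show "dist x y = 0 \<longleftrightarrow> x = y"
    by transfer simp
  show "dist x y \<le> dist x z + dist y z"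
    by transfer (metis dist_norm dist_triangle2)
qed (rule uniformity_circle_def open_circle_def)+

end

lift_definition circle_base :: circle is "1 :: complex"
  using cis_zero by (metis (mono_tags))

lemma circle_not_trivial: "\<exists>x y :: circle. x \<noteq> y"
proof -
  define x where "x = Abs_circle (cis 0)"
  define y where "y = Abs_circle (cis pi)"
  have "complex_of_circle x = cis 0" "complex_of_circle y = cis pi"
    unfolding x_def y_def by (rule Abs_circle_inverse; blast)+
  then have "x \<noteq> y" by auto
  then show ?thesis by blast
qed


section \<open>The Banach space of Lipschitz functions on the circle vanishing at the base point\<close>

typedef lip0 = "{f :: circle \<Rightarrow> real. (\<exists>L. L-lipschitz_on UNIV f) \<and> f circle_base = 0}"
  morphisms apply_lip0 Abs_lip0
  by (auto intro!: exI[of _ "\<lambda>_. 0"] exI[of _ 0] lipschitz_onI)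

setup_lifting type_definition_lip0

lemma lip0_eqI: "(\<And>x. apply_lip0 f x = apply_lip0 g x) \<Longrightarrow> f = g"
  by transfer auto

instantiation lip0 :: real_vector
begin

lift_definition zero_lip0 :: lip0 is "\<lambda>_. 0"
  by (auto intro!: exI[of _ 0] lipschitz_onI)

lift_definition uminus_lip0 :: "lip0 \<Rightarrow> lip0" is "\<lambda>f x. - f x"
  by (auto intro: lipschitz_on_minus)

lift_definition plus_lip0 :: "lip0 \<Rightarrow> lip0 \<Rightarrow> lip0" is "\<lambda>f g x. f x + g x"
  by (auto intro: lipschitz_on_add)

lift_definition minus_lip0 :: "lip0 \<Rightarrow> lip0 \<Rightarrow> lip0" is "\<lambda>f g x. f x - g x"
  by (auto intro: lipschitz_on_diff)

lift_definition scaleR_lip0 :: "real \<Rightarrow> lip0 \<Rightarrow> lip0" is "\<lambda>c f x. c * f x"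
  by (auto intro: lipschitz_on_cmult_real)

lemmas [simp] =
  uminus_lip0.rep_eq plus_lip0.rep_eq minus_lip0.rep_eq zero_lip0.rep_eq scaleR_lip0.rep_eq

instance
  by standard (auto intro!: lip0_eqI simp: algebra_simps)

end

lemma apply_lip0_base [simp]: "apply_lip0 f circle_base = 0"
  by transfer simp

definition lip_quotients :: "(circle \<Rightarrow> real) \<Rightarrow> real set"
  where "lip_quotients f = {\<bar>f x - f y\<bar> / dist x y | x y. x \<noteq> y}"

lemma lip_quotients_nonempty: "lip_quotients f \<noteq> {}"
  using circle_not_trivial by (auto simp: lip_quotients_def)

lemma lip_quotients_bdd_above: "bdd_above (lip_quotients (apply_lip0 f))"
proof -
  obtain L where L: "L-lipschitz_on UNIV (apply_lip0 f)"
    using apply_lip0[of f] by auto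
  show ?thesis
  proof (rule bdd_aboveI)
    fix r assume "r \<in> lip_quotients (apply_lip0 f)"
    then obtain x y where "x \<noteq> y" "r = \<bar>apply_lip0 f x - apply_lip0 f y\<bar> / dist x y"
      by (auto simp: lip_quotients_def)
    with lipschitz_onD[OF L, of x y] show "r \<le> L"
      by (simp add: pos_divide_le_eq dist_real_def)
  qed
qed

instantiation lip0 :: real_normed_vector
begin

definition norm_lip0 :: "lip0 \<Rightarrow> real"
  where "norm_lip0 f = Sup (lip_quotients (apply_lip0 f))"

definition dist_lip0 :: "lip0 \<Rightarrow> lip0 \<Rightarrow> real"
  where "dist_lip0 f g = norm (f - g)"

definition sgn_lip0 :: "lip0 \<Rightarrow> lip0"
  where "sgn_lip0 f = f /\<^sub>R norm f"

definition uniformity_lip0 :: "(lip0 \<times> lip0) filter"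
  where "uniformity_lip0 = (INF e\<in>{0 <..}. principal {(f, g). dist f g < e})"

definition open_lip0 :: "lip0 set \<Rightarrow> bool"
  where "open_lip0 U = (\<forall>f\<in>U. \<forall>\<^sub>F (f', g) in uniformity. f' = f \<longrightarrow> g \<in> U)"

lemma lip0_le_norm: "\<bar>apply_lip0 f x - apply_lip0 f y\<bar> \<le> norm f * dist x y"
proof (cases "x = y")
  case False
  then have "\<bar>apply_lip0 f x - apply_lip0 f y\<bar> / dist x y \<le> norm f"
    unfolding norm_lip0_def
    by (intro cSup_upper lip_quotients_bdd_above) (auto simp: lip_quotients_def)
  with False show ?thesis by (simp add: divide_simps)
qed simp

lemma lip0_norm_le:
  assumes "\<And>x y. \<bar>apply_lip0 f x - apply_lip0 f y\<bar> \<le> C * dist x y"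
  shows "norm f \<le> C"
  unfolding norm_lip0_def
proof (rule cSup_least[OF lip_quotients_nonempty])
  fix r assume "r \<in> lip_quotients (apply_lip0 f)"
  then obtain x y where "x \<noteq> y" "r = \<bar>apply_lip0 f x - apply_lip0 f y\<bar> / dist x y"
    by (auto simp: lip_quotients_def)
  with assms[of x y] show "r \<le> C" by (simp add: pos_divide_le_eq)
qed

lemma lip0_norm_nonneg: "0 \<le> norm (f :: lip0)"
proof -
  obtain x y :: circle where "x \<noteq> y" using circle_not_trivial by blast
  then have "0 \<le> norm f * dist x y" "0 < dist x y"
    using lip0_le_norm[of f x y] by (auto intro: order_trans[OF abs_ge_zero])
  then show ?thesis by (simp add: zero_le_mult_iff)
qed

lemma lip0_norm_scaleR_le: "norm (a *\<^sub>R f) \<le> \<bar>a\<bar> * norm (f :: lip0)"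
proof (rule lip0_norm_le)
  fix x y
  have "\<bar>apply_lip0 (a *\<^sub>R f) x - apply_lip0 (a *\<^sub>R f) y\<bar>
      = \<bar>a\<bar> * \<bar>apply_lip0 f x - apply_lip0 f y\<bar>"
    by (simp add: abs_mult[symmetric] right_diff_distrib)
  also have "\<dots> \<le> \<bar>a\<bar> * (norm f * dist x y)"
    by (rule mult_left_mono[OF lip0_le_norm]) simp
  finally show "\<bar>apply_lip0 (a *\<^sub>R f) x - apply_lip0 (a *\<^sub>R f) y\<bar> \<le> \<bar>a\<bar> * norm f * dist x y"
    by (simp add: mult.assoc)
qed

instance
proof
  fix a :: real and f g :: lip0
  show zero: "norm f = 0 \<longleftrightarrow> f = 0"
  proof
    assume "norm f = 0"
    then have "apply_lip0 f x = 0" for x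
      using lip0_le_norm[of f x circle_base] by simp
    then show "f = 0" by (auto intro: lip0_eqI)
  next
    assume "f = 0"
    then have "norm f \<le> 0" by (intro lip0_norm_le) simp
    with lip0_norm_nonneg[of f] show "norm f = 0" by simp
  qed
  show "norm (f + g) \<le> norm f + norm g"
  proof (rule lip0_norm_le)
    fix x y
    show "\<bar>apply_lip0 (f + g) x - apply_lip0 (f + g) y\<bar> \<le> (norm f + norm g) * dist x y"
      using lip0_le_norm[of f x y] lip0_le_norm[of g x y] by (simp add: distrib_right)
  qed
  show "norm (a *\<^sub>R f) = \<bar>a\<bar> * norm f"
  proof (cases "a = 0")
    case True
    have "norm (0 :: lip0) \<le> 0" by (intro lip0_norm_le) simp
    with lip0_norm_nonneg[of 0] True show ?thesis by simp
  next
    case False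
    then have "norm f \<le> \<bar>inverse a\<bar> * norm (a *\<^sub>R f)"
      using lip0_norm_scaleR_le[of "inverse a" "a *\<^sub>R f"] by simp
    with False have "\<bar>a\<bar> * norm f \<le> norm (a *\<^sub>R f)"
      by (simp add: field_simps abs_inverse)
    with lip0_norm_scaleR_le[of a f] show ?thesis by simp
  qed
qed (rule dist_lip0_def sgn_lip0_def uniformity_lip0_def open_lip0_def)+

end

instance lip0 :: banach
proof
  fix F :: "nat \<Rightarrow> lip0"
  assume F: "Cauchy F"
  have Cauchy_pt: "Cauchy (\<lambda>n. apply_lip0 (F n) x)" for x
  proof (rule metric_CauchyI)
    fix e :: real assume "0 < e"
    define K where "K = dist x circle_base + 1"
    have K: "0 < K" "dist x circle_base \<le> K" by (auto simp: K_def add_nonneg_pos)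
    with \<open>0 < e\<close> have "0 < e / K" by simp
    then obtain M where M: "\<And>m n. m \<ge> M \<Longrightarrow> n \<ge> M \<Longrightarrow> norm (F m - F n) < e / K"
      using F unfolding Cauchy_def dist_norm by blast
    show "\<exists>M. \<forall>m\<ge>M. \<forall>n\<ge>M. dist (apply_lip0 (F m) x) (apply_lip0 (F n) x) < e"
    proof (intro exI[of _ M] allI impI)
      fix m n assume "m \<ge> M" "n \<ge> M"
      have "\<bar>apply_lip0 (F m) x - apply_lip0 (F n) x\<bar> \<le> norm (F m - F n) * dist x circle_base"
        using lip0_le_norm[of "F m - F n" x circle_base] by simp
      also have "\<dots> \<le> norm (F m - F n) * K"
        using K by (intro mult_left_mono) auto
      also have "\<dots> < e"
        using M[OF \<open>m \<ge> M\<close> \<open>n \<ge> M\<close>] K by (simp add: field_simps)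
      finally show "dist (apply_lip0 (F m) x) (apply_lip0 (F n) x) < e"
        by (simp add: dist_real_def)
    qed
  qed
  define g where "g x = lim (\<lambda>n. apply_lip0 (F n) x)" for x
  have g: "(\<lambda>n. apply_lip0 (F n) x) \<longlonglongrightarrow> g x" for x
    using Cauchy_pt[of x] unfolding g_def
    by (simp add: Cauchy_convergent_iff convergent_LIMSEQ_iff)
  obtain B where B: "\<And>n. norm (F n) \<le> B"
    using Cauchy_Bseq[OF F] unfolding Bseq_def by blast
  have "B-lipschitz_on UNIV g"
  proof (rule lipschitz_onI)
    show "0 \<le> B" using B[of 0] norm_ge_zero[of "F 0"] by linarith
    fix x y
    have "\<bar>apply_lip0 (F n) x - apply_lip0 (F n) y\<bar> \<le> B * dist x y" for n
      using lip0_le_norm[of "F n" x y] mult_right_mono[OF B[of n] zero_le_dist[of x y]]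
      by linarith
    moreover have "(\<lambda>n. \<bar>apply_lip0 (F n) x - apply_lip0 (F n) y\<bar>) \<longlonglongrightarrow> \<bar>g x - g y\<bar>"
      by (intro tendsto_intros g)
    ultimately show "dist (g x) (g y) \<le> B * dist x y"
      unfolding dist_real_def by (intro LIMSEQ_le_const2) auto
  qed
  moreover have "g circle_base = 0"
    using g[of circle_base] by (simp add: LIMSEQ_const_iff)
  ultimately obtain G where G: "apply_lip0 G = g"
    using Abs_lip0_inverse[of g] by blast
  have "F \<longlonglongrightarrow> G"
  proof (rule metric_LIMSEQ_I)
    fix e :: real assume "0 < e"
    then obtain M where M: "\<And>m n. m \<ge> M \<Longrightarrow> n \<ge> M \<Longrightarrow> norm (F m - F n) < e / 2"
      using F unfolding Cauchy_def dist_norm by (metis half_gt_zero)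
    show "\<exists>M. \<forall>n\<ge>M. dist (F n) G < e"
    proof (intro exI[of _ M] allI impI)
      fix n assume "n \<ge> M"
      have "norm (F n - G) \<le> e / 2"
      proof (rule lip0_norm_le)
        fix x y
        have "\<bar>(apply_lip0 (F n) x - apply_lip0 (F m) x) - (apply_lip0 (F n) y - apply_lip0 (F m) y)\<bar>
            \<le> e / 2 * dist x y" if "m \<ge> M" for m
          using lip0_le_norm[of "F n - F m" x y]
            mult_right_mono[OF less_imp_le[OF M[OF \<open>n \<ge> M\<close> that]] zero_le_dist[of x y]]
          by simp
        moreover have "(\<lambda>m. \<bar>(apply_lip0 (F n) x - apply_lip0 (F m) x)
              - (apply_lip0 (F n) y - apply_lip0 (F m) y)\<bar>)
            \<longlonglongrightarrow> \<bar>(apply_lip0 (F n) x - g x) - (apply_lip0 (F n) y - g y)\<bar>"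
          by (intro tendsto_intros g)
        ultimately have "\<bar>(apply_lip0 (F n) x - g x) - (apply_lip0 (F n) y - g y)\<bar> \<le> e / 2 * dist x y"
          by (intro LIMSEQ_le_const2) auto
        then show "\<bar>apply_lip0 (F n - G) x - apply_lip0 (F n - G) y\<bar> \<le> e / 2 * dist x y"
          by (simp add: G)
      qed
      with \<open>0 < e\<close> show "dist (F n) G < e" by (simp add: dist_norm)
    qed
  qed
  then show "convergent F" by (rule convergentI)
qed


section \<open>Ball-covering properties\<close>

text \<open>A countable collection of balls is given by the countable set of the pairs
  (centre, radius); it may be finite.\<close>

definition has_BCP :: "'a::banach itself \<Rightarrow> bool"
  where "has_BCP _ \<longleftrightarrow>
    (\<exists>C :: ('a \<times> real) set. countable C \<and>
      (\<forall>(z, \<rho>)\<in>C. 0 < \<rho> \<and> \<rho> \<le> norm z) \<and>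
      sphere 0 1 \<subseteq> (\<Union>(z, \<rho>)\<in>C. ball z \<rho>))"

definition has_UBCP :: "'a::banach itself \<Rightarrow> bool"
  where "has_UBCP _ \<longleftrightarrow>
    (\<exists>r>0. \<exists>\<alpha>>0. \<exists>C :: ('a \<times> real) set. countable C \<and>
      (\<forall>(z, \<rho>)\<in>C. 0 < \<rho> \<and> \<rho> + \<alpha> \<le> norm z \<and> \<rho> \<le> r) \<and>
      sphere 0 1 \<subseteq> (\<Union>(z, \<rho>)\<in>C. ball z \<rho>))"

end

(* BCP: for a point x other than the base point 1, the function p |-> (d(p,1) - d(p,x)) / 2 has norm
   one, and by strict convexity of the circle its difference quotients approach 1 only at the pair
   (x,1). If f(x) > 0, subtracting f from N times this function, for N large, lowers the quotients near
   that pair, while all other quotients are already below N - ||f||; hence f lies in the ball of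
   radius N about this multiple. Countably many x suffice by density.

   Failure of UBCP: short arcs are almost geodesic, so a centre z of bounded norm with a nearly
   extremal quotient at two sufficiently close points has one within alpha at arbitrarily close
   points. Given countably many centres, there is a unit vector f that is flat on a sequence of very
   short pairs and uniformly small everywhere; subtracting it from z costs at most alpha. *)
theory Submission
  imports Defs
begin

section \<open>Points of the circle and elements of Lip_0\<close>

lemma norm_complex_of_circle [simp]: "cmod (complex_of_circle x) = 1"
  using complex_of_circle[of x] by auto

lemma circle_lift: "cmod w = 1 \<Longrightarrow> \<exists>x. complex_of_circle x = w"
  by (metis (mono_tags, lifting) Abs_circle_inverse mem_Collect_eq cis_Arg_unique
      complex_norm_eq_1_exp cis_conv_exp)

lemma lip0_exists:
  assumes "\<And>x y. \<bar>f x - f y\<bar> \<le> L * dist x y" "f circle_base = 0"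
  shows "\<exists>F. apply_lip0 F = f"
proof -
  have "\<bar>L\<bar>-lipschitz_on UNIV f"
  proof (rule lipschitz_onI)
    fix x y :: circle
    have "L * dist x y \<le> \<bar>L\<bar> * dist x y" by (intro mult_right_mono) auto
    with assms(1)[of x y] show "dist (f x) (f y) \<le> \<bar>L\<bar> * dist x y"
      by (simp add: dist_real_def)
  qed simp
  with assms(2) have "f \<in> {f. (\<exists>L. L-lipschitz_on UNIV f) \<and> f circle_base = 0}" by blast
  from Abs_lip0_inverse[OF this] show ?thesis by blast
qed

lemma lip0_norm_approx:
  assumes "c < norm (f :: lip0)"
  shows "\<exists>x y. x \<noteq> y \<and> apply_lip0 f x - apply_lip0 f y > c * dist x y"
proof -
  obtain x y where xy: "c * dist x y < \<bar>apply_lip0 f x - apply_lip0 f y\<bar>"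
    using lip0_norm_le[of f c] assms by (meson not_le)
  then have "x \<noteq> y" by auto
  show ?thesis
  proof (cases "apply_lip0 f x - apply_lip0 f y \<ge> 0")
    case True
    with xy \<open>x \<noteq> y\<close> show ?thesis by auto
  next
    case False
    with xy \<open>x \<noteq> y\<close> show ?thesis
      by (intro exI[of _ y] exI[of _ x]) (auto simp: dist_commute)
  qed
qed

section \<open>Difference quotients of distance functions on a sphere\<close>

text \<open>For unit vectors, \<open>q - p\<close> is orthogonal to \<open>p + q\<close>, so any
  multiple of \<open>p + q\<close> may be subtracted from \<open>y\<close>. The free constant
  \<open>c\<close> is chosen later to make the right-hand factor short.\<close>

lemma sphere_norm_diff_identity:
  fixes p q y :: "'a::real_inner"
  assumes "norm p = 1" "norm q = 1"
  shows "(norm (p - y) - norm (q - y)) * (norm (p - y) + norm (q - y))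
    = 2 * inner (q - p) (y - c *\<^sub>R (p + q))"
proof -
  have e: "inner p p = 1" "inner q q = 1"
    using assms by (simp_all add: norm_eq_1)
  have "(norm (p - y) - norm (q - y)) * (norm (p - y) + norm (q - y))
      = (norm (p - y))\<^sup>2 - (norm (q - y))\<^sup>2"
    by (simp add: power2_eq_square algebra_simps)
  also have "\<dots> = 2 * inner (q - p) (y - c *\<^sub>R (p + q))"
    by (simp add: power2_norm_eq_inner inner_diff inner_add e inner_commute algebra_simps)
  finally show ?thesis .
qed

text \<open>If \<open>P\<close> and \<open>Q\<close> differ, the limit is an equality case of the
  triangle inequality: \<open>Q\<close> lies on the segment from \<open>P\<close> to
  \<open>y\<close>, and a unit sphere has no point strictly between two others. If they coincide,
  the quotients are asymptotically bounded by the tangential part of the direction to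
  \<open>y\<close>, which has length less than 1 unless \<open>y\<close> is the common
  limit.\<close>

lemma sphere_dist_quotient_peak:
  fixes p q :: "nat \<Rightarrow> 'a::real_inner"
  assumes np: "\<And>n. norm (p n) = 1" and nq: "\<And>n. norm (q n) = 1" and ny: "norm y = 1"
    and P: "p \<longlonglongrightarrow> P" and Q: "q \<longlonglongrightarrow> Q" and ne: "\<And>n. p n \<noteq> q n"
    and lim: "(\<lambda>n. (norm (p n - y) - norm (q n - y)) / norm (p n - q n)) \<longlonglongrightarrow> 1"
  shows "Q = y"
proof -
  have nP: "norm P = 1" and nQ: "norm Q = 1"
    using tendsto_norm[OF P] tendsto_norm[OF Q] np nq by (simp_all add: LIMSEQ_const_iff)
  have ip: "inner P P = 1" "inner Q Q = 1" "inner y y = 1"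
    using nP nQ ny by (simp_all add: norm_eq_1)
  show ?thesis
  proof (cases "P = Q")
    case False
    have "(\<lambda>n. (norm (p n - y) - norm (q n - y)) / norm (p n - q n))
        \<longlonglongrightarrow> (norm (P - y) - norm (Q - y)) / norm (P - Q)"
      using False by (intro tendsto_intros P Q) auto
    from LIMSEQ_unique[OF this lim] False
    have "norm ((P - Q) + (Q - y)) = norm (P - Q) + norm (Q - y)"
      by (simp add: field_simps)
    then have col: "norm (P - Q) *\<^sub>R (Q - y) = norm (Q - y) *\<^sub>R (P - Q)"
      by (simp only: norm_triangle_eq)
    define c where "c = norm (Q - y) / norm (P - Q)"
    have "c \<ge> 0" by (simp add: c_def)
    have "Q - y = c *\<^sub>R (P - Q)"
      using arg_cong[OF col, of "\<lambda>v. v /\<^sub>R norm (P - Q)"] False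
      by (simp add: c_def divide_inverse mult.commute)
    then have y: "y = Q - c *\<^sub>R (P - Q)" by (simp add: algebra_simps)
    \<comment> \<open>On the unit sphere \<open>inner Q (P - Q)\<close> equals minus half the
      squared norm of \<open>P - Q\<close>. Hence moving from \<open>Q\<close> away from
      \<open>P\<close> leaves the sphere at once.\<close>
    have "inner y y = 1 + (c + c\<^sup>2) * (norm (P - Q))\<^sup>2"
      unfolding y power2_norm_eq_inner
      by (simp add: inner_diff inner_add ip inner_commute algebra_simps power2_eq_square)
    then have "(c + c\<^sup>2) * (norm (P - Q))\<^sup>2 = 0" using ip by simp
    then have "c + c\<^sup>2 = 0" using False by simp
    then have "c = 0" using \<open>c \<ge> 0\<close> zero_le_power2[of c] by linarith
    then show ?thesis using y by simp
  next
    case True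
    \<comment> \<open>\<open>c *\<^sub>R P\<close> is the orthogonal projection of \<open>y\<close>
      to the line through \<open>P\<close>. The factor \<open>c / 2\<close> appears below because
      \<open>p n + q n\<close> tends to twice \<open>P\<close>.\<close>
    define c where "c = inner y P"
    have le: "(norm (p n - y) - norm (q n - y)) / norm (p n - q n) * (norm (p n - y) + norm (q n - y))
        \<le> 2 * norm (y - (c / 2) *\<^sub>R (p n + q n))" for n
    proof -
      have "(norm (p n - y) - norm (q n - y)) * (norm (p n - y) + norm (q n - y))
          \<le> 2 * (norm (q n - p n) * norm (y - (c / 2) *\<^sub>R (p n + q n)))"
        unfolding sphere_norm_diff_identity[OF np[of n] nq[of n], of y "c / 2"]
        by (intro mult_left_mono norm_cauchy_schwarz) auto
      then show ?thesis using ne[of n]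
        by (simp add: divide_simps norm_minus_commute mult_ac)
    qed
    have "(\<lambda>n. (norm (p n - y) - norm (q n - y)) / norm (p n - q n)
          * (norm (p n - y) + norm (q n - y))) \<longlonglongrightarrow> 1 * (norm (P - y) + norm (Q - y))"
      by (intro tendsto_intros lim P Q)
    moreover have "(\<lambda>n. 2 * norm (y - (c / 2) *\<^sub>R (p n + q n)))
        \<longlonglongrightarrow> 2 * norm (y - (c / 2) *\<^sub>R (P + Q))"
      by (intro tendsto_intros P Q)
    ultimately have "1 * (norm (P - y) + norm (Q - y)) \<le> 2 * norm (y - (c / 2) *\<^sub>R (P + Q))"
      using le by (meson LIMSEQ_le)
    moreover have "(c / 2) *\<^sub>R (P + Q) = c *\<^sub>R P"
      using True by (simp flip: scaleR_add_left add: scaleR_add_right)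
    ultimately have "norm (P - y) \<le> norm (y - c *\<^sub>R P)" using True by simp
    then have le2: "inner (P - y) (P - y) \<le> inner (y - c *\<^sub>R P) (y - c *\<^sub>R P)"
      by (simp only: norm_le)
    have Py: "inner P y = c" "inner y P = c" by (simp_all add: c_def inner_commute)
    have e: "inner (P - y) (P - y) = 2 - 2 * c" by (simp add: inner_diff ip Py)
    have "inner (y - c *\<^sub>R P) (y - c *\<^sub>R P) = 1 - c\<^sup>2"
      by (simp add: inner_diff ip Py power2_eq_square)
    with le2 e have "(1 - c)\<^sup>2 \<le> 0" by (simp add: power2_diff)
    then have "c = 1" by simp
    then have "inner (P - y) (P - y) = 0" using e by simp
    then show ?thesis using True by simp
  qed
qed

section \<open>Peak functions and the ball-covering property\<close>

text \<open>Up to a constant, this is the average of two 1-Lipschitz functions, so a quotient near 1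
  forces both of theirs to be near 1. The added constant makes the value at the base point
  0.\<close>

definition peak :: "circle \<Rightarrow> lip0"
  where "peak x = Abs_lip0 (\<lambda>p. (dist p circle_base - dist p x + dist circle_base x) / 2)"

lemma apply_peak: "apply_lip0 (peak x) p = (dist p circle_base - dist p x + dist circle_base x) / 2"
proof -
  have "\<bar>(dist p circle_base - dist p x + dist circle_base x) / 2
     - (dist q circle_base - dist q x + dist circle_base x) / 2\<bar> \<le> 1 * dist p q" for p q
    using dist_triangle[of p x q] dist_triangle[of q x p]
      dist_triangle[of p circle_base q] dist_triangle[of q circle_base p]
    by (simp add: dist_commute abs_if field_simps)
  from lip0_exists[where L = 1, OF this]
  obtain F where "apply_lip0 F = (\<lambda>p. (dist p circle_base - dist p x + dist circle_base x) / 2)"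
    by auto
  then show ?thesis unfolding peak_def by (metis apply_lip0_inverse)
qed

lemma peak_diff:
  "apply_lip0 (peak x) p - apply_lip0 (peak x) q
    = ((dist p circle_base - dist q circle_base) + (dist q x - dist p x)) / 2"
  by (simp add: apply_peak field_simps)

text \<open>The norm is attained at the pair \<open>x\<close>, \<open>circle_base\<close>. A ball of
  radius \<open>N\<close> about \<open>N\<close> times the peak thus just meets the condition of the
  BCP on its centre.\<close>

lemma norm_peak:
  assumes "x \<noteq> circle_base"
  shows "norm (peak x) = 1"
proof (rule antisym)
  show "norm (peak x) \<le> 1"
  proof (rule lip0_norm_le)
    fix p q
    show "\<bar>apply_lip0 (peak x) p - apply_lip0 (peak x) q\<bar> \<le> 1 * dist p q"
      unfolding peak_diff
      using dist_triangle[of p x q] dist_triangle[of q x p]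
        dist_triangle[of p circle_base q] dist_triangle[of q circle_base p]
      by (simp add: dist_commute abs_if field_simps)
  qed
  show "1 \<le> norm (peak x)"
    using lip0_le_norm[of "peak x" x circle_base] assms unfolding peak_diff
    by (simp add: dist_commute)
qed

text \<open>If every \<open>N\<close> failed, there would be pairs almost extremal for
  \<open>N\<close> times the peak minus \<open>g\<close>. Both quotients averaged in the peak tend
  to 1 along them, so by compactness a subsequence converges to the pair \<open>x\<close>,
  \<open>circle_base\<close>. In the limit \<open>g\<close> does not increase from
  \<open>circle_base\<close> to \<open>x\<close>, against \<open>g\<close> being positive at
  \<open>x\<close>.\<close>

lemma peak_ball:
  assumes x: "apply_lip0 g x > 0"
  shows "\<exists>N>0. norm (real N *\<^sub>R peak x - g) < real N"
proof (rule ccontr)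
  assume contra: "\<not> ?thesis"
  let ?b = circle_base and ?c = complex_of_circle
  have dc: "dist p q = norm (?c p - ?c q)" for p q by transfer simp
  define K where "K = norm g"
  have "\<exists>p q. p \<noteq> q \<and> apply_lip0 (real (Suc n) *\<^sub>R peak x - g) p
      - apply_lip0 (real (Suc n) *\<^sub>R peak x - g) q > (real (Suc n) - 1 / real (Suc n)) * dist p q" for n
  proof (rule lip0_norm_approx)
    have "real (Suc n) \<le> norm (real (Suc n) *\<^sub>R peak x - g)"
      using contra by (metis not_le zero_less_Suc)
    moreover have "0 < 1 / real (Suc n)" by simp
    ultimately show "real (Suc n) - 1 / real (Suc n) < norm (real (Suc n) *\<^sub>R peak x - g)"
      by linarith
  qed
  then obtain p q where ne: "\<And>n. p n \<noteq> q n" and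
    pq: "\<And>n. apply_lip0 (real (Suc n) *\<^sub>R peak x - g) (p n)
      - apply_lip0 (real (Suc n) *\<^sub>R peak x - g) (q n)
      > (real (Suc n) - 1 / real (Suc n)) * dist (p n) (q n)" by metis
  define d where "d n = dist (p n) (q n)" for n
  have d: "d n > 0" for n using ne[of n] by (simp add: d_def)
  define u where "u n = (dist (p n) ?b - dist (q n) ?b) / d n" for n
  define v where "v n = (dist (q n) x - dist (p n) x) / d n" for n
  have u1: "u n \<le> 1" for n
    using d[of n] dist_triangle[of "p n" ?b "q n"] by (simp add: u_def d_def field_simps)
  have v1: "v n \<le> 1" for n
    using d[of n] dist_triangle[of "q n" x "p n"] by (simp add: v_def d_def dist_commute field_simps)
  have main: "real (Suc n) * ((u n + v n) / 2) * d n - (apply_lip0 g (p n) - apply_lip0 g (q n))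
      > (real (Suc n) - 1 / real (Suc n)) * d n" for n
  proof -
    have "(u n + v n) / 2 * d n = apply_lip0 (peak x) (p n) - apply_lip0 (peak x) (q n)"
      using d[of n] unfolding peak_diff u_def v_def by (simp add: field_simps)
    then have "real (Suc n) * ((u n + v n) / 2) * d n
        = real (Suc n) * (apply_lip0 (peak x) (p n) - apply_lip0 (peak x) (q n))"
      by (simp only: mult.assoc)
    then show ?thesis using pq[of n]
      by (simp only: d_def minus_lip0.rep_eq scaleR_lip0.rep_eq right_diff_distrib)
  qed
  \<comment> \<open>Subtracting \<open>g\<close> changes the quotient by at most \<open>K\<close>,
    and the tolerance is at most 1. Division by \<open>Suc n\<close> makes both losses vanish; as
    \<open>u\<close> and \<open>v\<close> stay below 1, each must tend to 1.\<close>
  have uv: "u n + v n \<ge> 2 - 2 * (1 + K) / real (Suc n)" for n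
  proof -
    have "- (apply_lip0 g (p n) - apply_lip0 g (q n)) \<le> K * d n"
      using lip0_le_norm[of g "p n" "q n"] by (simp add: K_def d_def)
    with main[of n] have "(real (Suc n) * ((u n + v n) / 2) + K) * d n
        > (real (Suc n) - 1 / real (Suc n)) * d n"
      by (simp add: distrib_right)
    then have "real (Suc n) * ((u n + v n) / 2) + K > real (Suc n) - 1 / real (Suc n)"
      using d[of n] by (simp only: mult_less_cancel_right_pos)
    moreover have "1 / real (Suc n) \<le> 1" by simp
    ultimately have "real (Suc n) * ((u n + v n) / 2) \<ge> real (Suc n) - (1 + K)" by linarith
    then show ?thesis by (simp add: field_simps)
  qed
  \<comment> \<open>\<open>Suc n\<close> times the peak rises by at most \<open>Suc n\<close> times
    the distance, which leaves only the tolerance to an increase of \<open>g\<close>. The factor 2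
    bounds the diameter of the circle.\<close>
  have gs: "apply_lip0 g (p n) - apply_lip0 g (q n) \<le> 2 * (1 / real (Suc n))" for n
  proof -
    have "real (Suc n) * ((u n + v n) / 2) * d n \<le> real (Suc n) * 1 * d n"
      using u1[of n] v1[of n] d[of n] by (intro mult_right_mono mult_left_mono) auto
    with main[of n] have "apply_lip0 g (p n) - apply_lip0 g (q n) \<le> 1 / real (Suc n) * d n"
      by (simp only: left_diff_distrib mult_1_right)
    also have "\<dots> \<le> 1 / real (Suc n) * 2"
      using norm_triangle_ineq4[of "?c (p n)" "?c (q n)"]
      by (intro mult_left_mono) (simp_all add: d_def dc)
    finally show ?thesis by (simp add: mult.commute divide_right_mono)
  qed
  have l0: "(\<lambda>n. 1 / real (Suc n)) \<longlonglongrightarrow> 0" by (rule LIMSEQ_Suc[OF lim_1_over_n])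
  have lb: "(\<lambda>n. 1 - 2 * (1 + K) * (1 / real (Suc n))) \<longlonglongrightarrow> 1"
    using tendsto_diff[OF tendsto_const tendsto_mult[OF tendsto_const[of "2 * (1 + K)"] l0], of 1]
    by simp
  have uv1: "1 - 2 * (1 + K) * (1 / real (Suc n)) \<le> u n" "1 - 2 * (1 + K) * (1 / real (Suc n)) \<le> v n" for n
    using uv[of n] u1[of n] v1[of n] unfolding times_divide_eq_right mult_1_right by linarith+
  have u: "u \<longlonglongrightarrow> 1"
    by (rule tendsto_sandwich[OF _ _ lb tendsto_const]) (use uv1 u1 in auto)
  have v: "v \<longlonglongrightarrow> 1"
    by (rule tendsto_sandwich[OF _ _ lb tendsto_const]) (use uv1 v1 in auto)
  have "compact (sphere (0::complex) 1 \<times> sphere (0::complex) 1)" by (intro compact_Times) auto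
  then obtain l r where r: "strict_mono r"
    and l: "((\<lambda>n. (?c (p n), ?c (q n))) \<circ> r) \<longlonglongrightarrow> l"
    unfolding compact_def by (metis (no_types, lifting) SigmaI mem_sphere_0 norm_complex_of_circle)
  have P: "(\<lambda>n. ?c (p (r n))) \<longlonglongrightarrow> fst l" and Q: "(\<lambda>n. ?c (q (r n))) \<longlonglongrightarrow> snd l"
    using tendsto_fst[OF l] tendsto_snd[OF l] by (simp_all add: o_def)
  have ne': "?c (p n) \<noteq> ?c (q n)" for n using d[of n] by (auto simp: d_def dc)
  have "snd l = ?c ?b"
    by (rule sphere_dist_quotient_peak[OF _ _ _ P Q])
      (use ne' LIMSEQ_subseq_LIMSEQ[OF u r] in \<open>auto simp: u_def d_def dc o_def\<close>)
  \<comment> \<open>In \<open>v\<close> the two endpoints exchange roles, so here the first one is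
    identified.\<close>
  moreover have "fst l = ?c x"
    by (rule sphere_dist_quotient_peak[OF _ _ _ Q P])
      (use ne'[symmetric] LIMSEQ_subseq_LIMSEQ[OF v r] in
        \<open>auto simp: v_def d_def dc o_def norm_minus_commute[of "?c (p _)" "?c (q _)"]\<close>)
  moreover have ac: "(\<lambda>n. apply_lip0 g (s n)) \<longlonglongrightarrow> apply_lip0 g z"
    if "(\<lambda>n. ?c (s n)) \<longlonglongrightarrow> ?c z" for s z
  proof (rule metric_tendsto_imp_tendsto)
    show "(\<lambda>n. K * dist (s n) z) \<longlonglongrightarrow> 0"
      using tendsto_mult_right_zero[OF tendsto_norm_zero[OF LIM_zero[OF that]]] by (simp add: dc)
    show "\<forall>\<^sub>F n in sequentially. dist (apply_lip0 g (s n)) (apply_lip0 g z) \<le> dist (K * dist (s n) z) 0"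
      using lip0_le_norm[of g] by (auto simp: K_def dist_real_def intro!: always_eventually)
  qed
  ultimately have "(\<lambda>n. apply_lip0 g (p (r n)) - apply_lip0 g (q (r n)))
      \<longlonglongrightarrow> apply_lip0 g x - apply_lip0 g ?b"
    using P Q by (intro tendsto_diff ac) auto
  moreover have "(\<lambda>n. 2 * (1 / real (Suc (r n)))) \<longlonglongrightarrow> 0"
    using tendsto_mult_right_zero[OF LIMSEQ_subseq_LIMSEQ[OF l0 r], of 2] by (simp add: o_def)
  ultimately have "apply_lip0 g x - apply_lip0 g ?b \<le> 0"
    using gs by (intro LIMSEQ_le) auto
  with x show False by simp
qed

text \<open>A nonzero Lipschitz function is nonzero at some point of any dense set. A countable
  dense set of peaks, both signs and all positive integer radii therefore suffice.\<close>

lemma has_BCP_lip0: "has_BCP TYPE(lip0)"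
proof -
  let ?c = complex_of_circle
  obtain T where T: "countable T" "T \<subseteq> sphere (0::complex) 1" "sphere (0::complex) 1 \<subseteq> closure T"
    by (rule separable)
  \<comment> \<open>The peak at the base point is zero and has to be left out; no \<open>f\<close>
    is lost, since \<open>f\<close> vanishes there.\<close>
  define D where "D = ?c -` T - {circle_base}"
  have "countable (?c -` T)"
    using T(1) by (intro countable_image_inj_on[of ?c] countable_subset[OF image_vimage_subset])
      (auto simp: inj_on_def complex_of_circle_inject)
  then have "countable D" by (simp add: D_def)
  define C where "C = (\<lambda>(x, s, N). ((s * real N) *\<^sub>R peak x, real N)) ` (D \<times> {1, -1} \<times> {N. N > 0})"
  have "sphere 0 1 \<subseteq> (\<Union>(z, \<rho>)\<in>C. ball z \<rho>)"
  proof
    fix f :: lip0 assume "f \<in> sphere 0 1"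
    then have nf: "norm f = 1" by simp
    then have "f \<noteq> 0" by auto
    then obtain x where x: "apply_lip0 f x \<noteq> 0" by (metis lip0_eqI zero_lip0.rep_eq)
    have "?c x \<in> closure T" using T(3) by auto
    then obtain w where w: "w \<in> T" "dist w (?c x) < \<bar>apply_lip0 f x\<bar>"
      using x unfolding closure_approachable by (metis zero_less_abs_iff)
    obtain y where y: "?c y = w" using w T(2) circle_lift[of w] by (metis mem_sphere_0 subsetD)
    have "\<bar>apply_lip0 f y - apply_lip0 f x\<bar> < \<bar>apply_lip0 f x\<bar>"
      using lip0_le_norm[of f y x] w nf unfolding y[symmetric]
      by (simp add: dist_circle.rep_eq dist_norm)
    then have fy: "apply_lip0 f y \<noteq> 0" by auto
    then have yD: "y \<in> D" using w y by (auto simp: D_def)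
    \<comment> \<open>Multiplication by the sign is an isometry and reduces to a positive value at
      \<open>y\<close>.\<close>
    define s where "s = sgn (apply_lip0 f y)"
    have s: "s \<in> {1, -1}" "s * s = 1" "\<bar>s\<bar> = 1" using fy by (auto simp: s_def sgn_if)
    have "apply_lip0 (s *\<^sub>R f) y > 0" using fy by (simp add: s_def sgn_if)
    from peak_ball[OF this] obtain N :: nat where N: "N > 0"
      "norm (real N *\<^sub>R peak y - s *\<^sub>R f) < real N" by auto
    have "real N *\<^sub>R peak y - s *\<^sub>R f = s *\<^sub>R ((s * real N) *\<^sub>R peak y - f)"
      using s(2) by (simp add: scaleR_diff_right flip: mult.assoc)
    with N(2) s(3) have "f \<in> ball ((s * real N) *\<^sub>R peak y) (real N)"
      by (simp add: dist_norm)
    moreover have "((s * real N) *\<^sub>R peak y, real N) \<in> C"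
      unfolding C_def using yD s(1) N(1) by force
    ultimately show "f \<in> (\<Union>(z, \<rho>)\<in>C. ball z \<rho>)" by blast
  qed
  moreover have "countable C" unfolding C_def using \<open>countable D\<close>
    by (intro countable_image countable_SIGMA) auto
  moreover have "\<forall>(z, \<rho>)\<in>C. 0 < \<rho> \<and> \<rho> \<le> norm z"
    by (auto simp: C_def D_def norm_peak)
  ultimately show ?thesis unfolding has_BCP_def by blast
qed

section \<open>Short arcs and steep pairs at small scales\<close>

lemma norm_cis_minus_1: "cmod (cis t - 1) = 2 * \<bar>sin (t / 2)\<bar>"
proof -
  have "cis t - 1 = cis (t / 2) * (cis (t / 2) - cis (- (t / 2)))"
    by (simp add: right_diff_distrib cis_mult)
  also have "cis (t / 2) - cis (- (t / 2)) = \<i> * complex_of_real (2 * sin (t / 2))"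
    by (simp add: complex_eq_iff)
  finally show ?thesis by (simp add: norm_mult)
qed

text \<open>The shorter arc from \<open>x\<close> to \<open>y\<close> is cut into \<open>N\<close>
  equal arcs. A chord is at most its arc, and a short arc is at most \<open>1 + \<kappa>\<close>
  times its chord because \<open>sin u / u\<close> tends to 1 at 0.\<close>

lemma circle_short_subdivision:
  assumes "\<kappa> > 0"
  shows "\<exists>\<delta>>0. \<forall>x y :: circle. 0 < dist x y \<and> dist x y < \<delta> \<longrightarrow> (\<forall>\<tau>>0. \<exists>N>0. \<exists>s :: nat \<Rightarrow> circle.
    s 0 = x \<and> s N = y \<and> (\<forall>i<N. s i \<noteq> s (Suc i) \<and> dist (s i) (s (Suc i)) < \<tau>
      \<and> real N * dist (s i) (s (Suc i)) \<le> (1 + \<kappa>) * dist x y))"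
proof -
  let ?c = complex_of_circle
  have dc: "dist p q = cmod (?c q - ?c p)" for p q by transfer (rule norm_minus_commute)
  have "((\<lambda>u::real. sin u / u) \<longlongrightarrow> 1) (at 0)"
    using DERIV_sin[of 0] by (simp add: has_field_derivative_iff)
  moreover have "1 / (1 + \<kappa>) < 1" using assms by simp
  ultimately have "\<forall>\<^sub>F u in at 0. 1 / (1 + \<kappa>) < sin u / u" by (rule order_tendstoD)
  then obtain \<eta>0 where "\<eta>0 > 0" and \<eta>0: "\<And>u. u \<noteq> 0 \<Longrightarrow> \<bar>u\<bar> < \<eta>0 \<Longrightarrow> 1 / (1 + \<kappa>) < sin u / u"
    by (auto simp: eventually_at dist_real_def)
  \<comment> \<open>The cap at \<open>pi / 2\<close> keeps to the range where the sine increases, so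
    that a small sine forces a small angle.\<close>
  define \<eta> where "\<eta> = min \<eta>0 (pi / 2)"
  have \<eta>: "0 < \<eta>" "\<eta> \<le> pi / 2" "\<eta> \<le> \<eta>0"
    using \<open>\<eta>0 > 0\<close> by (auto simp: \<eta>_def)
  have small: "\<bar>u\<bar> \<le> (1 + \<kappa>) * \<bar>sin u\<bar>" if "\<bar>sin u\<bar> < sin \<eta>" "\<bar>u\<bar> \<le> pi / 2" for u
  proof (cases "u = 0")
    case False
    have "sin \<bar>u\<bar> = \<bar>sin u\<bar>"
      using that(2) sin_ge_zero[of "\<bar>u\<bar>"] pi_gt_zero by (cases "u \<ge> 0") simp_all
    with that \<eta> have "\<bar>u\<bar> < \<eta>"
      using sin_monotone_2pi_le[of \<eta> "\<bar>u\<bar>"] by linarith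
    then have "1 / (1 + \<kappa>) < sin \<bar>u\<bar> / \<bar>u\<bar>" using \<eta>0[of "\<bar>u\<bar>"] \<eta> False by auto
    then show ?thesis using \<open>sin \<bar>u\<bar> = \<bar>sin u\<bar>\<close> assms False by (simp add: field_simps)
  qed simp
  show ?thesis
  proof (intro exI[of _ "2 * sin \<eta>"] conjI allI impI)
    show "2 * sin \<eta> > 0" using \<eta> by (simp add: sin_gt_zero)
    fix x y :: circle and \<tau> :: real
    assume xy: "0 < dist x y \<and> dist x y < 2 * sin \<eta>" and "\<tau> > 0"
    \<comment> \<open>The principal argument selects the shorter arc, so half of it lies within the
      range of \<open>small\<close>.\<close>
    define \<theta> where "\<theta> = Arg (?c y / ?c x)"
    have y: "?c y = ?c x * cis \<theta>"
    proof -
      have "?c x \<noteq> 0" "?c y \<noteq> 0"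
        by (metis norm_complex_of_circle norm_zero zero_neq_one)+
      then show ?thesis using cis_Arg[of "?c y / ?c x"] by (simp add: \<theta>_def sgn_eq norm_divide)
    qed
    have \<theta>: "\<bar>\<theta>\<bar> \<le> pi" using Arg_bounded[of "?c y / ?c x"] by (auto simp: \<theta>_def)
    have "?c y - ?c x = ?c x * (cis \<theta> - 1)" by (simp add: y algebra_simps)
    then have dxy: "dist x y = 2 * \<bar>sin (\<theta> / 2)\<bar>" by (simp add: dc norm_mult norm_cis_minus_1)
    have "\<theta> \<noteq> 0" using xy dxy by auto
    have \<theta>d: "\<bar>\<theta>\<bar> \<le> (1 + \<kappa>) * dist x y"
      using small[of "\<theta> / 2"] xy \<theta> by (simp add: dxy)
    obtain N :: nat where N: "real N > \<bar>\<theta>\<bar> / \<tau>" using reals_Archimedean2 by blast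
    then have "real N > 0" using \<open>\<tau> > 0\<close> by (meson abs_ge_zero divide_nonneg_pos order_le_less_trans)
    then have N0: "N > 0" by simp
    have "\<exists>s. ?c s = ?c x * cis (real i * \<theta> / real N)" for i
      by (rule circle_lift) (simp add: norm_mult)
    then obtain s where s: "\<And>i. ?c (s i) = ?c x * cis (real i * \<theta> / real N)" by metis
    have ds: "dist (s i) (s (Suc i)) = 2 * \<bar>sin (\<theta> / real N / 2)\<bar>" for i
    proof -
      have "?c (s (Suc i)) = ?c x * cis (real i * \<theta> / real N) * cis (\<theta> / real N)"
        by (simp add: s cis_mult mult.assoc add_divide_distrib distrib_right add.commute)
      then have "?c (s (Suc i)) - ?c (s i)
          = ?c x * cis (real i * \<theta> / real N) * (cis (\<theta> / real N) - 1)"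
        by (simp add: s algebra_simps)
      then show ?thesis by (simp add: dc norm_mult norm_cis_minus_1)
    qed
    have step_le: "dist (s i) (s (Suc i)) \<le> \<bar>\<theta>\<bar> / real N" for i
      using abs_sin_x_le_abs_x[of "\<theta> / real N / 2"] by (simp add: ds)
    have "\<bar>\<theta>\<bar> / real N < \<tau>" using N \<open>real N > 0\<close> \<open>\<tau> > 0\<close> by (simp add: field_simps)
    then have "dist (s i) (s (Suc i)) < \<tau>" for i using step_le by (rule le_less_trans[rotated])
    moreover have "s i \<noteq> s (Suc i)" for i
    proof
      assume "s i = s (Suc i)"
      then have "dist (s i) (s (Suc i)) = 0" by simp
      then have "sin \<bar>\<theta> / real N / 2\<bar> = 0" unfolding ds by (cases "\<theta> \<ge> 0") simp_all
      moreover have "\<bar>\<theta> / real N / 2\<bar> < pi"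
      proof -
        have "\<bar>\<theta>\<bar> / real N \<le> \<bar>\<theta>\<bar> / 1" using N0 by (intro divide_left_mono) auto
        moreover have "\<bar>\<theta> / real N / 2\<bar> = \<bar>\<theta>\<bar> / real N / 2" by (simp add: abs_divide)
        ultimately show ?thesis using \<theta> pi_gt_zero by linarith
      qed
      moreover have "\<bar>\<theta> / real N / 2\<bar> > 0" using \<open>\<theta> \<noteq> 0\<close> N0 by simp
      ultimately show False using sin_gt_zero by fastforce
    qed
    moreover have "s 0 = x" by (rule complex_of_circle_inject[THEN iffD1]) (simp add: s)
    moreover have "s N = y" by (rule complex_of_circle_inject[THEN iffD1]) (use N0 in \<open>simp add: s y\<close>)
    moreover have "real N * dist (s i) (s (Suc i)) \<le> (1 + \<kappa>) * dist x y" for i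
    proof -
      have "real N * dist (s i) (s (Suc i)) \<le> real N * (\<bar>\<theta>\<bar> / real N)"
        by (rule mult_left_mono[OF step_le]) simp
      then show ?thesis using N0 \<theta>d by simp
    qed
    ultimately show "\<exists>N>0. \<exists>s. s 0 = x \<and> s N = y \<and> (\<forall>i<N. s i \<noteq> s (Suc i)
        \<and> dist (s i) (s (Suc i)) < \<tau> \<and> real N * dist (s i) (s (Suc i)) \<le> (1 + \<kappa>) * dist x y)"
      using N0 by blast
  qed
qed

text \<open>A nearly extremal pair is either at least \<open>\<delta>\<close> apart or can be
  subdivided, and then some step is almost as steep. The point is that \<open>\<delta>\<close>
  depends on \<open>R\<close> and \<open>\<alpha>\<close> only, not on \<open>z\<close>. Distant
  pairs lose just \<open>\<alpha> / 2\<close>, which leaves room for a small perturbation.\<close>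

lemma lip0_steep_pair_dichotomy:
  assumes "\<alpha> > 0"
  shows "\<exists>\<delta>>0. \<forall>z :: lip0. norm z \<le> R \<and> \<alpha> \<le> norm z \<longrightarrow> (\<forall>\<tau>>0. \<exists>x y. x \<noteq> y \<and>
    (dist x y < \<tau> \<and> (norm z - \<alpha>) * dist x y \<le> \<bar>apply_lip0 z x - apply_lip0 z y\<bar> \<or>
     dist x y \<ge> \<delta> \<and> (norm z - \<alpha> / 2) * dist x y \<le> \<bar>apply_lip0 z x - apply_lip0 z y\<bar>))"
proof -
  \<comment> \<open>Chosen so that lengthening by the factor \<open>1 + \<kappa>\<close> costs at
    most \<open>\<alpha> / 2\<close> in the slope; the maximum with 1 keeps the denominator
    positive.\<close>
  define \<kappa> where "\<kappa> = \<alpha> / (2 * max R 1)"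
  have "\<kappa> > 0" using assms by (simp add: \<kappa>_def)
  then obtain \<delta> where "\<delta> > 0" and
    \<delta>: "\<forall>x y :: circle. 0 < dist x y \<and> dist x y < \<delta> \<longrightarrow> (\<forall>\<tau>>0. \<exists>N>0. \<exists>s :: nat \<Rightarrow> circle.
      s 0 = x \<and> s N = y \<and> (\<forall>i<N. s i \<noteq> s (Suc i) \<and> dist (s i) (s (Suc i)) < \<tau>
        \<and> real N * dist (s i) (s (Suc i)) \<le> (1 + \<kappa>) * dist x y))"
    using circle_short_subdivision[of \<kappa>] by blast
  show ?thesis
  proof (intro exI[of _ \<delta>] conjI \<open>\<delta> > 0\<close> allI impI)
    fix z :: lip0 and \<tau> :: real
    assume z: "norm z \<le> R \<and> \<alpha> \<le> norm z" and "\<tau> > 0"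
    have \<kappa>: "(norm z - \<alpha>) * (1 + \<kappa>) \<le> norm z - \<alpha> / 2"
    proof -
      have "(norm z - \<alpha>) * \<kappa> \<le> max R 1 * \<kappa>"
        using z \<open>\<kappa> > 0\<close> assms by (intro mult_right_mono) auto
      then show ?thesis by (simp add: \<kappa>_def algebra_simps)
    qed
    let ?f = "apply_lip0 z"
    obtain x y where "x \<noteq> y" and xy: "?f x - ?f y > (norm z - \<alpha> / 2) * dist x y"
      using lip0_norm_approx[of "norm z - \<alpha> / 2" z] assms by auto
    show "\<exists>x y. x \<noteq> y \<and>
      (dist x y < \<tau> \<and> (norm z - \<alpha>) * dist x y \<le> \<bar>?f x - ?f y\<bar> \<or>
       dist x y \<ge> \<delta> \<and> (norm z - \<alpha> / 2) * dist x y \<le> \<bar>?f x - ?f y\<bar>)"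
    proof (cases "dist x y \<ge> \<delta>")
      case True
      then show ?thesis using xy \<open>x \<noteq> y\<close>
        by (intro exI[of _ x] exI[of _ y]) linarith
    next
      case False
      then obtain N s where "N > 0" and sN: "s 0 = x" "s N = y"
        and s: "\<And>i. i < N \<Longrightarrow> s i \<noteq> s (Suc i)" "\<And>i. i < N \<Longrightarrow> dist (s i) (s (Suc i)) < \<tau>"
          "\<And>i. i < N \<Longrightarrow> real N * dist (s i) (s (Suc i)) \<le> (1 + \<kappa>) * dist x y"
        using \<delta>[rule_format, of x y \<tau>] \<open>x \<noteq> y\<close> \<open>\<tau> > 0\<close> by (auto simp: not_le)
      \<comment> \<open>Otherwise the increments, summed along the subdivision, would fall short of
        the increment between \<open>x\<close> and \<open>y\<close>.\<close>
      have "\<exists>i<N. (norm z - \<alpha>) * dist (s i) (s (Suc i)) \<le> \<bar>?f (s i) - ?f (s (Suc i))\<bar>"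
      proof (rule ccontr)
        assume "\<not> ?thesis"
        then have less: "\<bar>?f (s i) - ?f (s (Suc i))\<bar> < (norm z - \<alpha>) * dist (s i) (s (Suc i))"
          if "i < N" for i using that by force
        have "?f x - ?f y = (\<Sum>i<N. ?f (s i) - ?f (s (Suc i)))"
          using sN sum_lessThan_telescope'[of "\<lambda>i. ?f (s i)" N] by simp
        also have "\<dots> \<le> (\<Sum>i<N. (norm z - \<alpha>) * ((1 + \<kappa>) * dist x y / real N))"
        proof (rule sum_mono)
          fix i assume "i \<in> {..<N}"
          then have "i < N" by simp
          have "dist (s i) (s (Suc i)) \<le> (1 + \<kappa>) * dist x y / real N"
            using s(3)[OF \<open>i < N\<close>] \<open>N > 0\<close> by (simp add: field_simps)
          then have "(norm z - \<alpha>) * dist (s i) (s (Suc i))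
              \<le> (norm z - \<alpha>) * ((1 + \<kappa>) * dist x y / real N)"
            using z by (intro mult_left_mono) auto
          then show "?f (s i) - ?f (s (Suc i)) \<le> (norm z - \<alpha>) * ((1 + \<kappa>) * dist x y / real N)"
            using less[OF \<open>i < N\<close>] by linarith
        qed
        also have "\<dots> = (norm z - \<alpha>) * (1 + \<kappa>) * dist x y" using \<open>N > 0\<close> by simp
        also have "\<dots> \<le> (norm z - \<alpha> / 2) * dist x y" using \<kappa> by (intro mult_right_mono) auto
        finally show False using xy by simp
      qed
      then show ?thesis using s by blast
    qed
  qed
qed

section \<open>Small unit vectors that are flat on prescribed short pairs\<close>

text \<open>\<open>G t\<close> is the measure of what the intervals between \<open>a n\<close> and
  \<open>b n\<close> leave of \<open>{-1..t}\<close>. Their total length is at most 1, while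
  \<open>{-1..1}\<close> has length 2, so something is left.\<close>

lemma exists_mono_flat_on_intervals:
  fixes a b :: "nat \<Rightarrow> real"
  assumes ab: "\<And>n. \<bar>a n - b n\<bar> \<le> (1 / 2) ^ Suc n"
  shows "\<exists>G :: real \<Rightarrow> real. mono G \<and> (\<forall>s t. \<bar>G s - G t\<bar> \<le> \<bar>s - t\<bar>)
    \<and> (\<forall>n. G (a n) = G (b n)) \<and> G (-1) < G 1"
proof -
  define I where "I n = {min (a n) (b n)..max (a n) (b n)}" for n
  define U where "U = (\<Union>n. I n)"
  define G where "G t = measure lborel ({-1..t} - U)" for t
  have Ub [measurable]: "U \<in> sets borel" by (auto simp: U_def I_def)
  have fin: "emeasure lborel ({s..t} - V) < \<infinity>" if "V \<in> sets borel" for s t :: real and V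
    using emeasure_mono[of "{s..t} - V" "{s..t}" lborel] emeasure_lborel_cbox_finite[of s t]
    by (auto simp: order_le_less_trans)
  have Gmono: "G s \<le> G t" if "s \<le> t" for s t
    unfolding G_def using that fin
    by (intro measure_mono_fmeasurable) (auto simp: fmeasurable_def)
  \<comment> \<open>One estimate with two uses: \<open>V = {}\<close> gives the Lipschitz bound, and
    \<open>V = I n\<close> gives flatness on that interval.\<close>
  have Glip: "G t - G s \<le> measure lborel ({s..t} - V)"
    if "s \<le> t" "V \<in> sets borel" "V \<inter> {s<..t} \<subseteq> U" for s t V
  proof -
    have "G t \<le> measure lborel (({-1..s} - U) \<union> ({s..t} - V))"
      unfolding G_def using that fin
      by (intro measure_mono_fmeasurable fmeasurable.Un) (auto simp: fmeasurable_def)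
    also have "\<dots> \<le> G s + measure lborel ({s..t} - V)"
      unfolding G_def using that fin
      by (intro measure_Un_le) auto
    finally show ?thesis by simp
  qed
  have lip: "\<bar>G s - G t\<bar> \<le> \<bar>s - t\<bar>" for s t
  proof -
    have "G t - G s \<le> t - s" if "s \<le> t" for s t
      using Glip[OF that, of "{}"] that by simp
    from this[of s t] this[of t s] Gmono[of s t] Gmono[of t s] show ?thesis by linarith
  qed
  have flat: "G (a n) = G (b n)" for n
  proof -
    have "G (max (a n) (b n)) - G (min (a n) (b n)) \<le> 0"
    proof -
      have "I n \<inter> {min (a n) (b n)<..max (a n) (b n)} \<subseteq> U" by (auto simp: U_def)
      moreover have "min (a n) (b n) \<le> max (a n) (b n)" "I n \<in> sets borel" by (auto simp: I_def)
      ultimately show ?thesis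
        using Glip[of "min (a n) (b n)" "max (a n) (b n)" "I n"] by (simp add: I_def)
    qed
    moreover have "G (min (a n) (b n)) \<le> G (max (a n) (b n))" by (rule Gmono) simp
    ultimately show ?thesis by (cases "a n \<le> b n") (simp_all add: min_def max_def)
  qed
  have "emeasure lborel U \<le> (\<Sum>n. emeasure lborel (I n))"
    unfolding U_def by (rule emeasure_subadditive_countably) (auto simp: I_def)
  also have "\<dots> \<le> (\<Sum>n. ennreal ((1 / 2) ^ Suc n))"
  proof (intro suminf_le)
    fix n show "emeasure lborel (I n) \<le> ennreal ((1 / 2) ^ Suc n)"
      using ab[of n] by (auto simp: I_def max_def min_def intro!: ennreal_leI)
  qed auto
  also have "\<dots> = 1"
    using power_half_series by (simp add: suminf_ennreal2 sums_iff)
  finally have U1: "emeasure lborel U \<le> 1" .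
  have "ennreal 2 = emeasure lborel {-1..1::real}" by simp
  also have "\<dots> \<le> emeasure lborel (({-1..1} - U) \<union> U)" by (intro emeasure_mono) auto
  also have "\<dots> \<le> emeasure lborel ({-1..1} - U) + emeasure lborel U"
    by (intro emeasure_subadditive) auto
  also have "\<dots> \<le> ennreal (G 1) + 1"
    unfolding G_def using U1 fin[OF Ub, of "-1" 1]
    by (subst emeasure_eq_ennreal_measure) (auto intro: add_left_mono)
  finally have "ennreal 2 \<le> ennreal (G 1 + 1)"
    by (simp add: G_def ennreal_plus flip: ennreal_1)
  then have "G 1 \<ge> 1" by (subst (asm) ennreal_le_iff) (auto simp: G_def)
  moreover have "G (-1) \<le> 0"
    using fin[of "{}" "-1" "-1"] measure_mono_fmeasurable[of "{-1} - U" "{-1::real}" lborel]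
    by (auto simp: G_def fmeasurable_def)
  ultimately show ?thesis using lip flat Gmono by (intro exI[of _ G]) (auto intro: monoI)
qed

text \<open>On a grid of mesh \<open>2 / N\<close>, below \<open>\<eta>\<close>, some step must
  carry an increment; otherwise \<open>G\<close> would be constant along the grid from -1 to
  1.\<close>

lemma exists_close_increment:
  fixes G :: "real \<Rightarrow> real"
  assumes G: "mono G" "G (-1) < G 1" and "\<eta> > 0"
  shows "\<exists>s t. -1 \<le> s \<and> s < t \<and> t \<le> 1 \<and> t - s < \<eta> \<and> G s < G t"
proof (rule ccontr)
  assume contra: "\<not> ?thesis"
  obtain N :: nat where N: "real N > 2 / \<eta>" using reals_Archimedean2 by blast
  then have "real N > 0" using \<open>\<eta> > 0\<close> by (meson divide_pos_pos less_trans zero_less_numeral)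
  have "G (-1 + 2 * real k / real N) = G (-1)" if "k \<le> N" for k
    using that
  proof (induction k)
    case (Suc k)
    let ?s = "-1 + 2 * real k / real N" and ?t = "-1 + 2 * real (Suc k) / real N"
    have d: "?t - ?s = 2 / real N" by (simp add: diff_divide_distrib[symmetric])
    have "2 / real N > 0" "2 / real N < \<eta>"
      using \<open>real N > 0\<close> N \<open>\<eta> > 0\<close> by (auto simp: field_simps)
    with d have *: "?s < ?t" "?t - ?s < \<eta>" by linarith+
    have "2 * real (Suc k) / real N \<le> 2" using Suc.prems \<open>real N > 0\<close> by (simp add: field_simps)
    then have "?t \<le> 1" by linarith
    moreover have "-1 \<le> ?s" by simp
    ultimately have "\<not> G ?s < G ?t" using contra * by blast
    then have "G ?t = G ?s" using monoD[OF G(1), of ?s ?t] * by linarith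
    with Suc show ?case by simp
  qed simp
  from this[of N] show False using G(2) \<open>real N > 0\<close> by simp
qed

text \<open>The function is cut off to a band of height \<open>\<rho>\<close> that it crosses
  between two points at distance at most \<open>\<epsilon>\<close>. Its norm is then at least
  \<open>\<rho> / \<epsilon>\<close>, so normalising brings its values down to at most
  \<open>\<epsilon>\<close>.\<close>

lemma exists_small_flat_lip0:
  fixes a b :: "nat \<Rightarrow> circle"
  assumes ab: "\<And>n. dist (a n) (b n) \<le> (1 / 2) ^ Suc n" and "\<epsilon> > 0"
  shows "\<exists>f. norm f = 1 \<and> (\<forall>x. \<bar>apply_lip0 f x\<bar> \<le> \<epsilon>) \<and> (\<forall>n. apply_lip0 f (a n) = apply_lip0 f (b n))"
proof -
  let ?c = complex_of_circle
  have Re_le: "\<bar>Re (?c x) - Re (?c y)\<bar> \<le> dist x y" for x y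
    using abs_Re_le_cmod[of "?c x - ?c y"] by (simp add: dist_circle.rep_eq)
  then have "\<bar>Re (?c (a n)) - Re (?c (b n))\<bar> \<le> (1 / 2) ^ Suc n" for n
    using ab order_trans by blast
  from exists_mono_flat_on_intervals[OF this] obtain G :: "real \<Rightarrow> real" where
    G: "mono G" "\<And>s t. \<bar>G s - G t\<bar> \<le> \<bar>s - t\<bar>" "\<And>n. G (Re (?c (a n))) = G (Re (?c (b n)))" "G (-1) < G 1"
    by auto
  \<comment> \<open>The upper half circle, parametrised by the real part. Its uniform continuity
    turns close real parts into close points of the circle.\<close>
  define h where "h t = complex_of_real t + \<i> * complex_of_real (sqrt (1 - t\<^sup>2))" for t
  have "continuous_on {-1..1} h" unfolding h_def by (intro continuous_intros)
  then have "uniformly_continuous_on {-1..1} h" by (rule compact_uniformly_continuous) simp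
  then obtain \<eta> where "\<eta> > 0" and \<eta>: "\<And>s t. s \<in> {-1..1} \<Longrightarrow> t \<in> {-1..1} \<Longrightarrow> dist t s < \<eta> \<Longrightarrow> dist (h t) (h s) < \<epsilon>"
    unfolding uniformly_continuous_on_def using \<open>\<epsilon> > 0\<close> by metis
  obtain s t where st: "-1 \<le> s" "s < t" "t \<le> 1" "t - s < \<eta>" "G s < G t"
    using exists_close_increment[OF G(1,4) \<open>\<eta> > 0\<close>] by blast
  define \<rho> where "\<rho> = G t - G s"
  have "\<rho> > 0" using st by (simp add: \<rho>_def)
  \<comment> \<open>Composing with the 1-Lipschitz map \<open>Re\<close> transports flat functions on the line to the circle.\<close>
  define f where "f x = max (G s) (min (G (Re (?c x))) (G t)) - G t" for x
  have "\<bar>f x - f y\<bar> \<le> 1 * dist x y" for x y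
    using G(2)[of "Re (?c x)" "Re (?c y)"] Re_le[of x y] unfolding f_def by linarith
  \<comment> \<open>The base point has real part 1, at least \<open>t\<close>, so the cut-off takes
    its top value \<open>G t\<close> there.\<close>
  moreover have "f circle_base = 0"
    using monoD[OF G(1) \<open>t \<le> 1\<close>] st by (simp add: f_def circle_base.rep_eq)
  ultimately obtain F where F: "apply_lip0 F = f" using lip0_exists by blast
  have h1: "cmod (h u) = 1" "Re (h u) = u" if "-1 \<le> u" "u \<le> 1" for u
  proof -
    have "u\<^sup>2 \<le> 1" using that by (simp add: abs_le_iff abs_square_le_1)
    then show "cmod (h u) = 1" "Re (h u) = u" by (simp_all add: h_def cmod_def)
  qed
  obtain x y where x: "?c x = h s" and y: "?c y = h t"
    using circle_lift h1 st by (metis less_imp_le order_trans)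
  have "\<rho> = \<bar>f x - f y\<bar>"
    using st h1(2)[of s] h1(2)[of t] by (simp add: f_def x y \<rho>_def)
  also have "\<dots> \<le> norm F * dist x y" using lip0_le_norm[of F x y] by (simp add: F)
  also have "dist x y \<le> \<epsilon>" using \<eta>[of s t] st
    by (simp add: dist_circle.rep_eq x y dist_norm norm_minus_commute)
  finally have "\<rho> \<le> norm F * \<epsilon>" by (simp add: mult_left_mono)
  then have "norm F > 0" using \<open>\<rho> > 0\<close> \<open>\<epsilon> > 0\<close> by (metis norm_eq_zero mult_zero_left not_le zero_less_norm_iff)
  show ?thesis
  proof (intro exI[of _ "F /\<^sub>R norm F"] conjI allI)
    show "norm (F /\<^sub>R norm F) = 1" using \<open>norm F > 0\<close> by simp
    fix x
    have "\<bar>f x\<bar> \<le> \<rho>" using \<open>\<rho> > 0\<close> by (auto simp: f_def \<rho>_def max_def min_def)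
    then have "\<bar>f x\<bar> \<le> norm F * \<epsilon>" using \<open>\<rho> \<le> norm F * \<epsilon>\<close> by linarith
    then show "\<bar>apply_lip0 (F /\<^sub>R norm F) x\<bar> \<le> \<epsilon>"
      using \<open>norm F > 0\<close> by (simp add: F abs_mult field_simps)
  next
    fix n show "apply_lip0 (F /\<^sub>R norm F) (a n) = apply_lip0 (F /\<^sub>R norm F) (b n)"
      using G(3)[of n] by (simp add: F f_def)
  qed
qed

section \<open>Failure of the uniform ball-covering property\<close>

text \<open>Each relevant centre contributes one steep pair, short of summable length or at least
  \<open>\<delta>\<close> apart. A single unit vector \<open>f\<close>, flat on the short pairs and
  small everywhere, lowers no centre's slope at its pair below \<open>norm z - \<alpha>\<close>, so
  it lies in none of the balls.\<close>

lemma not_has_UBCP_lip0: "\<not> has_UBCP TYPE(lip0)"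
proof
  assume "has_UBCP TYPE(lip0)"
  then obtain r \<alpha> and C :: "(lip0 \<times> real) set" where "r > 0" "\<alpha> > 0" "countable C"
    and C: "\<And>z \<rho>. (z, \<rho>) \<in> C \<Longrightarrow> 0 < \<rho> \<and> \<rho> + \<alpha> \<le> norm z \<and> \<rho> \<le> r"
    and cover: "sphere 0 1 \<subseteq> (\<Union>(z, \<rho>)\<in>C. ball z \<rho>)"
    unfolding has_UBCP_def by fast
  \<comment> \<open>A ball of radius at most \<open>r\<close> can contain a unit vector only if its
    centre has norm at most \<open>r + 1\<close>.\<close>
  define S where "S = {z \<in> fst ` C. norm z \<le> r + 1}"
  have "countable S" using \<open>countable C\<close> by (auto simp: S_def intro: countable_subset[of _ "fst ` C"])
  obtain \<delta> where "\<delta> > 0" and \<delta>: "\<forall>z :: lip0. norm z \<le> r + 1 \<and> \<alpha> \<le> norm z \<longrightarrow> (\<forall>\<tau>>0. \<exists>x y. x \<noteq> y \<and>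
    (dist x y < \<tau> \<and> (norm z - \<alpha>) * dist x y \<le> \<bar>apply_lip0 z x - apply_lip0 z y\<bar> \<or>
     dist x y \<ge> \<delta> \<and> (norm z - \<alpha> / 2) * dist x y \<le> \<bar>apply_lip0 z x - apply_lip0 z y\<bar>))"
    using lip0_steep_pair_dichotomy[OF \<open>\<alpha> > 0\<close>, of "r + 1"] by blast
  \<comment> \<open>For empty \<open>S\<close> the values are arbitrary, whence the guard
    \<open>Z n \<in> S\<close> in what follows.\<close>
  define Z where "Z = from_nat_into S"
  have "\<exists>x y. Z n \<in> S \<longrightarrow> x \<noteq> y \<and>
    (dist x y < (1 / 2) ^ Suc n \<and> (norm (Z n) - \<alpha>) * dist x y \<le> \<bar>apply_lip0 (Z n) x - apply_lip0 (Z n) y\<bar> \<or>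
     dist x y \<ge> \<delta> \<and> (norm (Z n) - \<alpha> / 2) * dist x y \<le> \<bar>apply_lip0 (Z n) x - apply_lip0 (Z n) y\<bar>)" for n
  proof (cases "Z n \<in> S")
    case True
    then obtain \<rho> where "(Z n, \<rho>) \<in> C" "norm (Z n) \<le> r + 1" by (auto simp: S_def)
    moreover have "\<alpha> \<le> norm (Z n)" using C[OF \<open>(Z n, \<rho>) \<in> C\<close>] by linarith
    moreover have "(1 / 2 :: real) ^ Suc n > 0" by simp
    ultimately show ?thesis using \<delta> by blast
  qed simp
  then obtain x y where xy: "\<And>n. Z n \<in> S \<Longrightarrow> x n \<noteq> y n"
    "\<And>n. Z n \<in> S \<Longrightarrow>
     dist (x n) (y n) < (1 / 2) ^ Suc n
       \<and> (norm (Z n) - \<alpha>) * dist (x n) (y n) \<le> \<bar>apply_lip0 (Z n) (x n) - apply_lip0 (Z n) (y n)\<bar> \<or>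
     dist (x n) (y n) \<ge> \<delta>
       \<and> (norm (Z n) - \<alpha> / 2) * dist (x n) (y n) \<le> \<bar>apply_lip0 (Z n) (x n) - apply_lip0 (Z n) (y n)\<bar>"
    by metis
  \<comment> \<open>A pair that is not short is made degenerate, so flatness there asks for
    nothing.\<close>
  define y' where "y' n = (if dist (x n) (y n) < (1 / 2) ^ Suc n then y n else x n)" for n
  have "dist (x n) (y' n) \<le> (1 / 2) ^ Suc n" for n by (auto simp: y'_def)
  \<comment> \<open>Two values of this size differ by at most
    \<open>\<alpha> * \<delta> / 2\<close>, hence by at most \<open>\<alpha> / 2\<close> times the
    distance of points at least \<open>\<delta>\<close> apart.\<close>
  moreover have "\<alpha> * \<delta> / 4 > 0" using \<open>\<alpha> > 0\<close> \<open>\<delta> > 0\<close> by simp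
  ultimately obtain f where f: "norm f = 1" "\<And>x. \<bar>apply_lip0 f x\<bar> \<le> \<alpha> * \<delta> / 4"
    "\<And>n. apply_lip0 f (x n) = apply_lip0 f (y' n)"
    using exists_small_flat_lip0[of x y' "\<alpha> * \<delta> / 4"] by blast
  have "f \<in> sphere 0 1" using f by simp
  then obtain z \<rho> where z: "(z, \<rho>) \<in> C" "f \<in> ball z \<rho>" using cover by blast
  have "norm z \<le> norm (z - f) + norm f" using norm_triangle_sub[of z f] by simp
  also have "\<dots> \<le> r + 1" using z C[of z \<rho>] f by (auto simp: dist_norm)
  finally have "z \<in> S" using z by (force simp: S_def)
  then obtain n where n: "z = Z n" unfolding Z_def
    using \<open>countable S\<close> by (metis from_nat_into_to_nat_on)
  let ?d = "dist (x n) (y n)"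
  have "?d > 0" using xy(1)[of n] \<open>z \<in> S\<close> n by simp
  have "(norm z - \<alpha>) * ?d \<le> \<bar>apply_lip0 (z - f) (x n) - apply_lip0 (z - f) (y n)\<bar>"
    using xy(2)[of n, folded n, OF \<open>z \<in> S\<close>]
  proof
    assume h: "?d < (1 / 2) ^ Suc n \<and> (norm z - \<alpha>) * ?d \<le> \<bar>apply_lip0 z (x n) - apply_lip0 z (y n)\<bar>"
    then show ?thesis using f(3)[of n] by (simp add: y'_def)
  next
    assume h: "?d \<ge> \<delta> \<and> (norm z - \<alpha> / 2) * ?d \<le> \<bar>apply_lip0 z (x n) - apply_lip0 z (y n)\<bar>"
    have "\<alpha> * \<delta> \<le> \<alpha> * ?d" using h \<open>\<alpha> > 0\<close> by simp
    then have "\<bar>apply_lip0 f (x n) - apply_lip0 f (y n)\<bar> \<le> \<alpha> / 2 * ?d"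
      using f(2)[of "x n"] f(2)[of "y n"] by linarith
    moreover have "(norm z - \<alpha>) * ?d = (norm z - \<alpha> / 2) * ?d - \<alpha> / 2 * ?d"
      by (simp add: field_simps)
    ultimately show ?thesis using h unfolding minus_lip0.rep_eq by linarith
  qed
  also have "\<dots> \<le> norm (z - f) * ?d" by (rule lip0_le_norm)
  finally have "norm z - \<alpha> \<le> norm (z - f)" using \<open>?d > 0\<close> by simp
  moreover have "norm (z - f) < \<rho>" using z by (simp add: dist_norm)
  ultimately show False using C[OF z(1)] by linarith
qed

theorem theorem5p2:
  shows "has_BCP TYPE(lip0) \<and> \<not> has_UBCP TYPE(lip0)"
  using has_BCP_lip0 not_has_UBCP_lip0 by blast

end
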